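(* Let $\gamma,\alpha\in(0,1)$. For testing $H_i:P\in\omega_i$, $i=1,\ldots,s$, suppose that each p-value $\hat p_i$ satisfies $$P\{\hat p_i\le u\}\le u\quad\text{for any } u\in(0,1)\text{ and any } P\in\omega_i .$$ Consider the stepdown procedure with constants $$\alpha_i'=\frac{\alpha_i}{C_{\lfloor\gamma s\rfloor+1}},\qquad \alpha_i=\frac{(\lfloor\gamma i\rfloor+1)\alpha}{s+\lfloor\gamma i\rfloor+1-i},\qquad i=1,\ldots,s,$$ where $C_j=\sum_{i=1}^{j}\frac1i$. Then $P\{FDP>\gamma\}\le\alpha$.
   Context: Data $X$ is available from some model $P\in\Omega$. A hypothesis $H_i$ is identified with a subset $\omega_i\subset\Omega$ and asserts $P\in\omega_i$. $I(P)=\{i: P\in\omega_i\}$ is the set of indices of true null hypotheses under the true distribution $P$. The p-values $\hat p_1,\ldots,\hat p_s$ are $[0,1]$-valued statistics (functions of $X$); no assumption is made on their joint dependence structure. Let $\hat p_{(1)}\le\cdots\le\hat p_{(s)}$ be the ordered p-values and $H_{(1)},\ldots,H_{(s)}$ the associated hypotheses (ties ordered arbitrarily). Given constants $\alpha_1'\le\alpha_2'\le\cdots\le\alpha_s'$, the stepdown procedure with these constants is: if $\hat p_{(1)}>\alpha_1'$, reject no hypotheses; otherwise reject $H_{(1)},\ldots,H_{(r)}$, where $r$ is the largest index such that $\hat p_{(1)}\le\alpha_1',\ldots,\hat p_{(r)}\le\alpha_r'$. The false discovery proportion $FDP$ is the number of false rejections (rejected $H_i$ with $i\in I(P)$) divided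 by the total number of rejections, and is defined to be $0$ if there are no rejections. $\lfloor x\rfloor$ is the greatest integer $\le x$. *)

theory Defs
  imports "HOL-Probability.Probability"
begin

text \<open>
  Hypotheses are indexed by \<open>{1..s}\<close>. A distribution is a probability measure on the sample space,
  and the hypothesis \<open>H i\<close> is the set \<open>\<omega> i\<close> of distributions satisfying it.
\<close>

definition true_nulls :: "nat \<Rightarrow> (nat \<Rightarrow> 'x measure set) \<Rightarrow> 'x measure \<Rightarrow> nat set" where
  "true_nulls s \<omega> P = {i \<in> {1..s}. P \<in> \<omega> i}"

text \<open>
  \<open>\<tau> k\<close> is the index of the hypothesis with the \<open>k\<close>-th smallest p-value, so that
  \<open>q (\<tau> k)\<close> is the \<open>k\<close>-th order statistic. In the presence of ties several \<open>\<tau>\<close> qualify.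
\<close>

definition sorts_pvalues :: "nat \<Rightarrow> (nat \<Rightarrow> real) \<Rightarrow> (nat \<Rightarrow> nat) \<Rightarrow> bool" where
  "sorts_pvalues s q \<tau> \<longleftrightarrow> bij_betw \<tau> {1..s} {1..s} \<and> mono_on {1..s} (\<lambda>k. q (\<tau> k))"

text \<open>
  The index \<open>r = 0\<close> always satisfies the condition vacuously; the maximum is \<open>0\<close> exactly if the
  smallest p-value exceeds \<open>c 1\<close> (or \<open>s = 0\<close>), in which case nothing is rejected.
\<close>

definition stepdown_count :: "nat \<Rightarrow> (nat \<Rightarrow> real) \<Rightarrow> (nat \<Rightarrow> real) \<Rightarrow> (nat \<Rightarrow> nat) \<Rightarrow> nat" where
  "stepdown_count s c q \<tau> = Max {r. r \<le> s \<and> (\<forall>k\<in>{1..r}. q (\<tau> k) \<le> c k)}"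

definition stepdown_rejections ::
    "nat \<Rightarrow> (nat \<Rightarrow> real) \<Rightarrow> (nat \<Rightarrow> real) \<Rightarrow> (nat \<Rightarrow> nat) \<Rightarrow> nat set" where
  "stepdown_rejections s c q \<tau> = \<tau> ` {1..stepdown_count s c q \<tau>}"

definition false_discovery_proportion :: "nat set \<Rightarrow> nat set \<Rightarrow> real" where
  "false_discovery_proportion R I = (if R = {} then 0 else real (card (R \<inter> I)) / real (card R))"

definition fdp_const :: "nat \<Rightarrow> real \<Rightarrow> real \<Rightarrow> nat \<Rightarrow> real" where
  "fdp_const s \<gamma> \<alpha> i =
     (of_int \<lfloor>\<gamma> * real i\<rfloor> + 1) * \<alpha> / (real s + of_int \<lfloor>\<gamma> * real i\<rfloor> + 1 - real i)"

text \<open>\<open>harm j\<close> is the harmonic sum \<open>1/1 + \<dots> + 1/j\<close>.\<close>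

definition fdp_const' :: "nat \<Rightarrow> real \<Rightarrow> real \<Rightarrow> nat \<Rightarrow> real" where
  "fdp_const' s \<gamma> \<alpha> i = fdp_const s \<gamma> \<alpha> i / harm (nat \<lfloor>\<gamma> * real s\<rfloor> + 1)"

end

theory Submission
  imports Defs
begin

text \<open>
  Fix the true distribution and let \<open>I\<close> be the set of true null hypotheses. Run through the
  rejections in the order of their p-values. If the final proportion of false rejections exceeds
  \<open>\<gamma>\<close>, stop at the first \<open>j\<close> at which the proportion among the first \<open>j\<close> rejections exceeds
  \<open>\<gamma>\<close>. As the number of false rejections grows by at most one in each step, at this moment it is
  exactly \<open>m = \<lfloor>\<gamma> j\<rfloor> + 1\<close> (lemma \<open>first_crossing\<close>). The other \<open>j - m\<close> rejections are among the
  \<open>s - card I\<close> false hypotheses, so \<open>card I \<le> s + m - j\<close>, and the right-hand side is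
  the denominator of \<open>\<alpha>\<^sub>j\<close>. Hence \<open>m\<close> true p-values lie below
  \<open>\<alpha>\<^sub>j / C \<le> m \<alpha> / (C card I)\<close>, where \<open>C = harm (\<lfloor>\<gamma> s\<rfloor> + 1)\<close>: the random index \<open>j\<close>
  has been traded for the index \<open>m \<le> \<lfloor>\<gamma> s\<rfloor> + 1\<close> of a deterministic linear barrier for the
  order statistics of the true p-values alone.

  Under arbitrary dependence, the probability that for some \<open>m\<close> the \<open>m\<close>-th order statistic is
  below a barrier \<open>\<beta> m\<close> is at most \<open>card I\<close> times the sum of \<open>(\<beta> m - \<beta> (m - 1)) / m\<close>
  (lemma \<open>prob_order_statistic_le_barrier\<close>). For the linear barrier this sum is a multiple of a
  harmonic sum, which the factor \<open>1 / C\<close> in the constants cancels.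

  The event \<open>FDP > \<gamma>\<close> is measurable although \<open>\<sigma>\<close> may break ties in a non-measurable
  way: since the constants increase, tied hypotheses are rejected together, so the rejected set
  depends only on which inequalities \<open>p i x \<le> c k\<close> hold.
\<close>

section \<open>Order statistics and the rejected set\<close>

lemma order_statistic_le_iff:
  assumes "sorts_pvalues s q \<tau>" "k \<in> {1..s}"
  shows "q (\<tau> k) \<le> u \<longleftrightarrow> k \<le> card {i\<in>{1..s}. q i \<le> u}"
proof -
  have bij: "bij_betw \<tau> {1..s} {1..s}" and mono: "mono_on {1..s} (\<lambda>k. q (\<tau> k))"
    using assms(1) by (auto simp: sorts_pvalues_def)
  have img: "\<tau> ` {1..s} = {1..s}" using bij by (rule bij_betw_imp_surj_on)
  have "{i\<in>\<tau> ` {1..s}. q i \<le> u} = \<tau> ` {l\<in>{1..s}. q (\<tau> l) \<le> u}" by blast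
  moreover have "inj_on \<tau> {l\<in>{1..s}. q (\<tau> l) \<le> u}"
    by (rule inj_on_subset[OF bij_betw_imp_inj_on[OF bij]]) blast
  ultimately have card_eq: "card {i\<in>{1..s}. q i \<le> u} = card {l\<in>{1..s}. q (\<tau> l) \<le> u}"
    unfolding img by (simp add: card_image)
  show ?thesis
  proof
    assume le: "q (\<tau> k) \<le> u"
    have "{1..k} \<subseteq> {l\<in>{1..s}. q (\<tau> l) \<le> u}"
    proof
      fix l assume "l \<in> {1..k}"
      then have "q (\<tau> l) \<le> q (\<tau> k)" "l \<in> {1..s}"
        using mono_onD[OF mono, of l k] assms(2) by auto
      then show "l \<in> {l\<in>{1..s}. q (\<tau> l) \<le> u}" using le by simp
    qed
    from card_mono[OF _ this] show "k \<le> card {i\<in>{1..s}. q i \<le> u}" unfolding card_eq by simp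
  next
    assume card: "k \<le> card {i\<in>{1..s}. q i \<le> u}"
    show "q (\<tau> k) \<le> u"
    proof (rule ccontr)
      assume "\<not> q (\<tau> k) \<le> u"
      have "{l\<in>{1..s}. q (\<tau> l) \<le> u} \<subseteq> {1..<k}"
      proof
        fix l assume l: "l \<in> {l\<in>{1..s}. q (\<tau> l) \<le> u}"
        then have "\<not> k \<le> l"
          using mono_onD[OF mono, of k l] assms(2) \<open>\<not> q (\<tau> k) \<le> u\<close> by force
        with l show "l \<in> {1..<k}" by simp
      qed
      from card_mono[OF _ this] have "k \<le> card {1..<k}"
        using card unfolding card_eq by simp
      then show False using assms(2) by auto
    qed
  qed
qed

lemma stepdown_count_props:
  shows "stepdown_count s c q \<tau> \<le> s"
    and "\<And>k. k \<in> {1..stepdown_count s c q \<tau>} \<Longrightarrow> q (\<tau> k) \<le> c k"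
    and "stepdown_count s c q \<tau> < s \<Longrightarrow>
           c (Suc (stepdown_count s c q \<tau>)) < q (\<tau> (Suc (stepdown_count s c q \<tau>)))"
proof -
  let ?A = "{r. r \<le> s \<and> (\<forall>k\<in>{1..r}. q (\<tau> k) \<le> c k)}"
  let ?r = "stepdown_count s c q \<tau>"
  have fin: "finite ?A" by simp
  have "0 \<in> ?A" by simp
  then have mem: "?r \<in> ?A" unfolding stepdown_count_def using Max_in[OF fin] by blast
  then show "?r \<le> s" "\<And>k. k \<in> {1..?r} \<Longrightarrow> q (\<tau> k) \<le> c k" by auto
  assume "?r < s"
  have "Suc ?r \<notin> ?A"
  proof
    assume "Suc ?r \<in> ?A"
    then have "Suc ?r \<le> ?r" using Max_ge[OF fin] by (simp only: stepdown_count_def)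
    then show False by simp
  qed
  then obtain k where k: "k \<in> {1..Suc ?r}" "\<not> q (\<tau> k) \<le> c k"
    using \<open>?r < s\<close> by auto
  have "k \<notin> {1..?r}" using k(2) mem by blast
  then have "k = Suc ?r" using k(1) by simp
  then show "c (Suc ?r) < q (\<tau> (Suc ?r))" using k(2) by simp
qed

text \<open>
  Rejection by rank coincides with rejection by threshold: by monotonicity of \<open>c\<close>, the first
  accepted p-value, and with it all accepted ones, exceeds the last critical value that was met. The guard \<open>1 \<le> r\<close> is there
  because \<open>c 0\<close> is not a critical value.
\<close>

lemma stepdown_rejections_eq_threshold:
  assumes sorts: "sorts_pvalues s q \<tau>" and c: "mono_on {1..s} c"
  defines "r \<equiv> stepdown_count s c q \<tau>"
  shows "stepdown_rejections s c q \<tau> = {i\<in>{1..s}. 1 \<le> r \<and> q i \<le> c r}"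
proof -
  note props = stepdown_count_props[where s=s and c=c and q=q and \<tau>=\<tau>, folded r_def]
  have mono: "mono_on {1..s} (\<lambda>k. q (\<tau> k))" and img: "\<tau> ` {1..s} = {1..s}"
    using sorts by (auto simp: sorts_pvalues_def bij_betw_def)
  have le: "k \<le> r \<longleftrightarrow> 1 \<le> r \<and> q (\<tau> k) \<le> c r" if k: "k \<in> {1..s}" for k
  proof
    assume "k \<le> r"
    then show "1 \<le> r \<and> q (\<tau> k) \<le> c r"
      using mono_onD[OF mono, of k r] props(1) props(2)[of r] k by auto
  next
    assume *: "1 \<le> r \<and> q (\<tau> k) \<le> c r"
    show "k \<le> r"
    proof (rule ccontr)
      assume "\<not> k \<le> r"
      then have "c r \<le> c (Suc r)" "c (Suc r) < q (\<tau> (Suc r))" "q (\<tau> (Suc r)) \<le> q (\<tau> k)"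
        using mono_onD[OF c, of r "Suc r"] mono_onD[OF mono, of "Suc r" k] props(3) k *
        by auto
      with * show False by simp
    qed
  qed
  have "{1..r} = {k\<in>{1..s}. k \<le> r}" using props(1) by auto
  then have "stepdown_rejections s c q \<tau> = \<tau> ` {k\<in>{1..s}. k \<le> r}"
    unfolding stepdown_rejections_def r_def[symmetric] by (rule arg_cong)
  also have "{k\<in>{1..s}. k \<le> r} = {k\<in>{1..s}. 1 \<le> r \<and> q (\<tau> k) \<le> c r}"
    using le by blast
  also have "\<tau> ` \<dots> = {i\<in>\<tau> ` {1..s}. 1 \<le> r \<and> q i \<le> c r}" by blast
  finally show ?thesis unfolding img .
qed

text \<open>
  In particular the way in which ties are broken does not matter, because \<open>\<tau>\<close> and \<open>\<tau>'\<close> are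
  unrelated here.
\<close>

lemma stepdown_rejections_cong:
  assumes sorts: "sorts_pvalues s q \<tau>" "sorts_pvalues s q' \<tau>'" and c: "mono_on {1..s} c"
    and same: "\<And>i k. i \<in> {1..s} \<Longrightarrow> k \<in> {1..s} \<Longrightarrow> q i \<le> c k \<longleftrightarrow> q' i \<le> c k"
  shows "stepdown_rejections s c q \<tau> = stepdown_rejections s c q' \<tau>'"
proof -
  have "q (\<tau> k) \<le> c k \<longleftrightarrow> q' (\<tau>' k) \<le> c k" if "k \<in> {1..s}" for k
  proof -
    have "{i\<in>{1..s}. q i \<le> c k} = {i\<in>{1..s}. q' i \<le> c k}" using same that by blast
    then show ?thesis
      unfolding order_statistic_le_iff[OF sorts(1) that] order_statistic_le_iff[OF sorts(2) that]
      by simp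
  qed
  then have "(\<forall>k\<in>{1..r}. q (\<tau> k) \<le> c k) \<longleftrightarrow> (\<forall>k\<in>{1..r}. q' (\<tau>' k) \<le> c k)" if "r \<le> s" for r
    using that by (intro ball_cong) auto
  then have "{r. r \<le> s \<and> (\<forall>k\<in>{1..r}. q (\<tau> k) \<le> c k)} =
      {r. r \<le> s \<and> (\<forall>k\<in>{1..r}. q' (\<tau>' k) \<le> c k)}"
    by blast
  then have count: "stepdown_count s c q \<tau> = stepdown_count s c q' \<tau>'"
    unfolding stepdown_count_def by simp
  define r where "r = stepdown_count s c q' \<tau>'"
  have "r \<le> s" unfolding r_def by (rule stepdown_count_props(1))
  then have "1 \<le> r \<and> q i \<le> c r \<longleftrightarrow> 1 \<le> r \<and> q' i \<le> c r" if "i \<in> {1..s}" for i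
    using same[OF that, of r] by (cases "1 \<le> r") simp_all
  then show ?thesis
    unfolding stepdown_rejections_eq_threshold[OF sorts(1) c]
      stepdown_rejections_eq_threshold[OF sorts(2) c] count r_def[symmetric]
    by blast
qed

section \<open>Measurability\<close>

text \<open>
  The tie-breaking \<open>\<sigma>\<close> is an arbitrary function of the sample, so measurability cannot be composed
  from measurable parts. Instead the sample space is cut into the finitely many atoms generated
  by the events \<open>Q a\<close>, and \<open>\<phi>\<close> is constant on each atom.
\<close>

lemma sets_determined_by_finitely_many_events:
  assumes A: "finite A" and ev: "\<And>a. a \<in> A \<Longrightarrow> {x \<in> space M. Q a x} \<in> sets M"
    and det: "\<And>x y. x \<in> space M \<Longrightarrow> y \<in> space M \<Longrightarrow> (\<And>a. a \<in> A \<Longrightarrow> Q a x \<longleftrightarrow> Q a y) \<Longrightarrow> \<phi> x \<Longrightarrow> \<phi> y"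
  shows "{x \<in> space M. \<phi> x} \<in> sets M"
proof -
  let ?pat = "\<lambda>x. {a\<in>A. Q a x}"
  let ?D = "?pat ` {x \<in> space M. \<phi> x}"
  have "?D \<subseteq> Pow A" by auto
  then have fin: "finite ?D" using A finite_subset by blast
  have cell: "{x \<in> space M. \<forall>a\<in>A. Q a x \<longleftrightarrow> a \<in> D} \<in> sets M" for D
  proof (rule sets.sets_Collect_finite_All[OF _ A])
    fix a assume "a \<in> A"
    show "{x \<in> space M. Q a x \<longleftrightarrow> a \<in> D} \<in> sets M"
      using ev[OF \<open>a \<in> A\<close>] sets.sets_Collect_neg[of M "Q a"] by (cases "a \<in> D") simp_all
  qed
  have "{x \<in> space M. \<phi> x} = (\<Union>D\<in>?D. {x \<in> space M. \<forall>a\<in>A. Q a x \<longleftrightarrow> a \<in> D})"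
  proof (intro subset_antisym subsetI)
    fix x assume "x \<in> {x \<in> space M. \<phi> x}"
    then show "x \<in> (\<Union>D\<in>?D. {x \<in> space M. \<forall>a\<in>A. Q a x \<longleftrightarrow> a \<in> D})" by auto
  next
    fix x assume "x \<in> (\<Union>D\<in>?D. {x \<in> space M. \<forall>a\<in>A. Q a x \<longleftrightarrow> a \<in> D})"
    then obtain y where "y \<in> space M" "\<phi> y" "x \<in> space M" "\<forall>a\<in>A. Q a x \<longleftrightarrow> Q a y" by auto
    then show "x \<in> {x \<in> space M. \<phi> x}" using det[of y x] by blast
  qed
  also have "\<dots> \<in> sets M" using fin cell by (intro sets.finite_UN) auto
  finally show ?thesis .
qed

lemma sets_order_statistic_le_barrier:
  fixes X :: "'i \<Rightarrow> 'a \<Rightarrow> real"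
  assumes I: "finite I" and X: "\<And>i. i \<in> I \<Longrightarrow> X i \<in> borel_measurable M"
  shows "{x \<in> space M. \<exists>m\<in>{1..N}. m \<le> card {i\<in>I. X i x \<le> \<beta> m}} \<in> sets M"
proof (rule sets_determined_by_finitely_many_events[where A="I \<times> {1..N}"
      and Q="\<lambda>a x. X (fst a) x \<le> \<beta> (snd a)"])
  show "finite (I \<times> {1..N})" using I by simp
  show "{x \<in> space M. X (fst a) x \<le> \<beta> (snd a)} \<in> sets M" if "a \<in> I \<times> {1..N}" for a
  proof -
    have [measurable]: "X (fst a) \<in> borel_measurable M" using that by (intro X) auto
    show ?thesis by measurable
  qed
  fix x y
  assume same: "\<And>a. a \<in> I \<times> {1..N} \<Longrightarrow>
      (X (fst a) x \<le> \<beta> (snd a)) = (X (fst a) y \<le> \<beta> (snd a))"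
  assume "\<exists>m\<in>{1..N}. m \<le> card {i\<in>I. X i x \<le> \<beta> m}"
  then obtain m where m: "m \<in> {1..N}" "m \<le> card {i\<in>I. X i x \<le> \<beta> m}" by blast
  have "{i\<in>I. X i x \<le> \<beta> m} = {i\<in>I. X i y \<le> \<beta> m}"
    using same[of "(_, m)"] m(1) by auto
  with m show "\<exists>m\<in>{1..N}. m \<le> card {i\<in>I. X i y \<le> \<beta> m}" by auto
qed

section \<open>Order statistics below a barrier under arbitrary dependence\<close>

text \<open>
  Summation by parts. The left-hand side has nonnegative weights, so it is monotone in \<open>f\<close>, which
  is invisible on the right-hand side.
\<close>

lemma sum_increments_by_parts:
  fixes f :: "nat \<Rightarrow> real"
  assumes "f 0 = 0"
  shows "(\<Sum>m=1..N. f m / (real m * real (Suc m))) + f N / real (Suc N)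
       = (\<Sum>m=1..N. (f m - f (m - 1)) / real m)"
proof (induction N)
  case 0
  show ?case using assms by simp
next
  case (Suc N)
  have "f (Suc N) / (real (Suc N) * real (Suc (Suc N))) + f (Suc N) / real (Suc (Suc N))
      = f (Suc N) / real (Suc N)"
    by (simp add: divide_simps) (simp add: algebra_simps)
  then show ?case using Suc by (simp add: diff_divide_distrib)
qed

text \<open>
  Give an index \<open>i\<close> the weight \<open>1 / m\<close> if \<open>m\<close> is the first level with \<open>X i \<le> \<beta> m\<close>, and
  the weight \<open>0\<close> if there is no such level. If at least \<open>m\<close> indices lie below \<open>\<beta> m\<close>, each
  of them has weight at least \<open>1 / m\<close>, so the total weight is at least \<open>1\<close>. By Markov's
  inequality the probability is therefore at most the expected total weight, in which only the
  marginal distributions enter. Summation by parts shows that the expected weight of one index is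
  increasing in the probabilities of \<open>X i \<le> \<beta> m\<close>, so these may be replaced by \<open>\<beta> m\<close>.
\<close>

lemma (in prob_space) prob_order_statistic_le_barrier:
  fixes X :: "'i \<Rightarrow> 'a \<Rightarrow> real" and \<beta> :: "nat \<Rightarrow> real"
  assumes I: "finite I" and X: "\<And>i. i \<in> I \<Longrightarrow> X i \<in> borel_measurable M"
    and \<beta>: "\<beta> 0 = 0" "mono_on {1..N} \<beta>"
    and marginal: "\<And>i m. i \<in> I \<Longrightarrow> m \<in> {1..N} \<Longrightarrow> prob {x \<in> space M. X i x \<le> \<beta> m} \<le> \<beta> m"
  shows "prob {x \<in> space M. \<exists>m\<in>{1..N}. m \<le> card {i\<in>I. X i x \<le> \<beta> m}}
       \<le> real (card I) * (\<Sum>m=1..N. (\<beta> m - \<beta> (m - 1)) / real m)"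
proof (cases "N = 0")
  case True
  then show ?thesis by simp
next
  case False
  define E where "E = {x \<in> space M. \<exists>m\<in>{1..N}. m \<le> card {i\<in>I. X i x \<le> \<beta> m}}"
  define L where "L i m = {x \<in> space M. X i x \<le> \<beta> m}" for i m
  \<comment> \<open>For \<open>f m\<close> the indicator of \<open>X i \<le> \<beta> m\<close>, \<open>w f\<close> is the weight of the index \<open>i\<close>.\<close>
  define w where "w f = (\<Sum>m=1..N. f m / (real m * real (Suc m))) + f N / real (Suc N)"
    for f :: "nat \<Rightarrow> real"
  have L: "L i m \<in> events" if "i \<in> I" for i m
    unfolding L_def using X[OF that] by measurable
  have w_mono: "w f \<le> w g" if "\<And>m. m \<in> {1..N} \<Longrightarrow> f m \<le> g m" for f g
    unfolding w_def using that False by (intro add_mono sum_mono divide_right_mono) auto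
  have w_eq: "w f = (\<Sum>m=1..N. (f m - f (m - 1)) / real m)" if "f 0 = 0" for f
    unfolding w_def by (rule sum_increments_by_parts[of f, OF that])
  \<comment> \<open>The increments of a unit step at \<open>k\<close> vanish except at \<open>k\<close>.\<close>
  have w_step: "w (\<lambda>m. if k \<le> m then 1 else 0) = 1 / real k" if k: "k \<in> {1..N}" for k
  proof -
    have "((if k \<le> m then 1 else 0) - (if k \<le> m - 1 then 1 else 0)) / real m
        = (if m = k then 1 / real k else 0)" if "m \<in> {1..N}" for m
      using k that by auto
    then have "(\<Sum>m=1..N. ((if k \<le> m then 1 else 0) - (if k \<le> m - 1 then 1 else 0)) / real m)
        = (\<Sum>m=1..N. if m = k then 1 / real k else 0)"
      by (rule sum.cong[OF refl])
    moreover have "w (\<lambda>m. if k \<le> m then 1 else 0)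
        = (\<Sum>m=1..N. ((if k \<le> m then 1 else 0) - (if k \<le> m - 1 then 1 else 0)) / real m)"
      using k by (intro w_eq) simp
    moreover have "(\<Sum>m=1..N. if m = k then 1 / real k else 0) = 1 / real k" using k by simp
    ultimately show ?thesis by simp
  qed
  have ge1: "indicator E x \<le> (\<Sum>i\<in>I. w (\<lambda>m. indicator (L i m) x))" if x: "x \<in> space M" for x
  proof (cases "x \<in> E")
    case True
    then obtain k where k: "k \<in> {1..N}" and card: "k \<le> card {i\<in>I. X i x \<le> \<beta> k}"
      unfolding E_def by blast
    let ?J = "{i\<in>I. X i x \<le> \<beta> k}"
    have nonneg: "0 \<le> w (\<lambda>m. indicator (L i m) x)" for i
      unfolding w_def by (intro add_nonneg_nonneg sum_nonneg) auto
    have "1 / real k \<le> w (\<lambda>m. indicator (L i m) x)" if i: "i \<in> ?J" for i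
      unfolding w_step[OF k, symmetric]
    proof (rule w_mono)
      fix m assume "m \<in> {1..N}"
      then have "X i x \<le> \<beta> m" if "k \<le> m"
        using mono_onD[OF \<beta>(2), of k m] k i that by auto
      then show "(if k \<le> m then 1 else 0) \<le> (indicator (L i m) x :: real)"
        using x by (auto simp: L_def)
    qed
    then have "real (card ?J) * (1 / real k) \<le> (\<Sum>i\<in>?J. w (\<lambda>m. indicator (L i m) x))"
      by (rule sum_bounded_below)
    also have "\<dots> \<le> (\<Sum>i\<in>I. w (\<lambda>m. indicator (L i m) x))"
      using I nonneg by (intro sum_mono2) auto
    finally have "real (card ?J) * (1 / real k) \<le> (\<Sum>i\<in>I. w (\<lambda>m. indicator (L i m) x))" .
    moreover have "1 \<le> real (card ?J) * (1 / real k)" using k card by simp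
    ultimately show ?thesis using True by simp
  next
    case False
    then show ?thesis
      unfolding w_def by (auto intro!: sum_nonneg add_nonneg_nonneg)
  qed
  have E: "E \<in> events"
    unfolding E_def using I X by (rule sets_order_statistic_le_barrier)
  have int: "integrable M (\<lambda>x. indicator (L i m) x :: real)" if "i \<in> I" for i m
    using L[OF that] by (simp add: emeasure_eq_measure)
  have intw: "integrable M (\<lambda>x. w (\<lambda>m. indicator (L i m) x))" if "i \<in> I" for i
    unfolding w_def using int[OF that]
    by (intro Bochner_Integration.integrable_add Bochner_Integration.integrable_sum
        integrable_divide_zero) auto
  have expw: "expectation (\<lambda>x. w (\<lambda>m. indicator (L i m) x)) = w (\<lambda>m. prob (L i m))"
    if i: "i \<in> I" for i
  proof -
    have e: "expectation (\<lambda>x. indicator (L i m) x / c) = prob (L i m) / c" for m and c :: real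
      using L[OF i, of m] sets.sets_into_space by (simp add: Int_absorb2)
    have d: "integrable M (\<lambda>x. indicator (L i m) x / c)" for m and c :: real
      using int[OF i] by simp
    show ?thesis
      unfolding w_def
      by (subst Bochner_Integration.integral_add[OF Bochner_Integration.integrable_sum[OF d] d],
          subst Bochner_Integration.integral_sum[OF d]) (simp only: e)
  qed
  have "prob E = expectation (indicator E)"
    using sets.sets_into_space[OF E] by (simp add: Int_absorb2)
  also have "\<dots> \<le> expectation (\<lambda>x. \<Sum>i\<in>I. w (\<lambda>m. indicator (L i m) x))"
    using ge1 E intw
    by (intro integral_mono Bochner_Integration.integrable_sum) (auto simp: emeasure_eq_measure)
  also have "\<dots> = (\<Sum>i\<in>I. w (\<lambda>m. prob (L i m)))"
    using intw by (simp add: Bochner_Integration.integral_sum expw)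
  also have "\<dots> \<le> (\<Sum>i\<in>I. w \<beta>)"
    using marginal by (intro sum_mono w_mono) (auto simp: L_def)
  finally show ?thesis
    by (simp add: w_eq[of \<beta>, OF \<beta>(1)] E_def)
qed

section \<open>The critical constants\<close>

text \<open>
  Since \<open>\<gamma> \<le> 1\<close>, \<open>\<lfloor>\<gamma> i\<rfloor>\<close> grows by \<open>0\<close> or \<open>1\<close> from \<open>i\<close> to \<open>i + 1\<close>. In the first case the
  denominator of \<open>fdp_const\<close> decreases; in the second it is unchanged while the numerator increases.
\<close>

lemma fdp_const'_mono:
  assumes "0 \<le> \<gamma>" "\<gamma> \<le> 1" "0 \<le> \<alpha>"
  shows "mono_on {1..s} (fdp_const' s \<gamma> \<alpha>)"
proof -
  have step: "fdp_const s \<gamma> \<alpha> i \<le> fdp_const s \<gamma> \<alpha> (Suc i)" if "Suc i \<le> s" for i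
  proof -
    let ?f = "real_of_int \<lfloor>\<gamma> * real i\<rfloor>" and ?g = "real_of_int \<lfloor>\<gamma> * real (Suc i)\<rfloor>"
    have "\<gamma> * real i \<le> \<gamma> * real (Suc i)" "\<gamma> * real (Suc i) \<le> \<gamma> * real i + 1"
      using assms by (auto simp: algebra_simps)
    then have "\<lfloor>\<gamma> * real i\<rfloor> \<le> \<lfloor>\<gamma> * real (Suc i)\<rfloor>" "\<lfloor>\<gamma> * real (Suc i)\<rfloor> \<le> \<lfloor>\<gamma> * real i\<rfloor> + 1"
      by linarith+
    then have g: "?f \<le> ?g" "?g \<le> ?f + 1" by linarith+
    have f: "0 \<le> ?f" using assms by simp
    have s: "real (Suc i) \<le> real s" using that by linarith
    have "0 < real s + ?g + 1 - real (Suc i)" using s f g by linarith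
    moreover have "0 \<le> (?g + 1) * \<alpha>" using f g assms(3) by (intro mult_nonneg_nonneg) linarith+
    ultimately show ?thesis
      unfolding fdp_const_def using assms g s
      by (intro frac_le mult_right_mono) auto
  qed
  show ?thesis
  proof (rule mono_onI)
    fix i j assume "i \<in> {1..s}" "j \<in> {1..s}" "i \<le> j"
    from \<open>i \<le> j\<close> have "j \<le> s \<longrightarrow> fdp_const s \<gamma> \<alpha> i \<le> fdp_const s \<gamma> \<alpha> j"
    proof (induction rule: dec_induct)
      case (step n)
      then show ?case using \<open>\<And>i. Suc i \<le> s \<Longrightarrow> _\<close>[of n] by auto
    qed simp
    then show "fdp_const' s \<gamma> \<alpha> i \<le> fdp_const' s \<gamma> \<alpha> j"
      unfolding fdp_const'_def using \<open>j \<in> {1..s}\<close>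
      by (intro divide_right_mono) (auto intro: harm_nonneg)
  qed
qed

section \<open>Reduction to the true p-values\<close>

text \<open>
  At the first crossing of the line of slope \<open>\<gamma>\<close> the count is known exactly: it was at most
  \<open>\<gamma> (j - 1)\<close> one step earlier and has grown by at most one.
\<close>

lemma first_crossing:
  fixes n :: "nat \<Rightarrow> nat"
  assumes "0 \<le> \<gamma>" "n 0 = 0" and step: "\<And>j. n (Suc j) \<le> Suc (n j)"
    and cross: "\<gamma> * real r < real (n r)"
  obtains j where "j \<in> {1..r}" "n j = nat \<lfloor>\<gamma> * real j\<rfloor> + 1"
proof -
  define j where "j = (LEAST j. \<gamma> * real j < real (n j))"
  have j: "\<gamma> * real j < real (n j)" "j \<le> r"
    unfolding j_def using cross by (rule LeastI, rule Least_le)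
  have "j \<noteq> 0" using j(1) assms(2) by (cases "j = 0") simp_all
  then obtain i where i: "j = Suc i" by (cases j) auto
  have "real (n i) \<le> \<gamma> * real i"
    using not_less_Least[of i "\<lambda>j. \<gamma> * real j < real (n j)"] i unfolding j_def[symmetric] by simp
  moreover have "real (n j) \<le> real (n i) + 1" using step[of i] i by simp
  moreover have "\<gamma> * real i \<le> \<gamma> * real j" using assms(1) i by (simp add: mult_left_mono)
  ultimately have "\<lfloor>\<gamma> * real j\<rfloor> = int (n j) - 1" using j(1) by linarith
  moreover have "0 \<le> \<lfloor>\<gamma> * real j\<rfloor>" using assms(1) by simp
  ultimately have "n j = nat \<lfloor>\<gamma> * real j\<rfloor> + 1" by linarith
  with that[of j] j(2) \<open>j \<noteq> 0\<close> show thesis by simp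
qed

text \<open>
  At the first crossing, \<open>m = \<lfloor>\<gamma> j\<rfloor> + 1\<close> true hypotheses are among the first \<open>j\<close> rejections, and
  the other \<open>j - m\<close> places are taken by some of the \<open>s - card I\<close> false hypotheses. Replacing the
  denominator \<open>s + m - j\<close> of the \<open>j\<close>-th constant by the smaller \<open>card I\<close> gives a bound that
  depends on \<open>j\<close> through \<open>m\<close> only.
\<close>

lemma fdp_exceeds_imp_order_statistic_le_barrier:
  assumes \<gamma>: "0 \<le> \<gamma>" and \<alpha>: "0 \<le> \<alpha>"
    and sorts: "sorts_pvalues s q \<tau>" and I: "I \<subseteq> {1..s}"
    and fdp: "false_discovery_proportion (stepdown_rejections s (fdp_const' s \<gamma> \<alpha>) q \<tau>) I > \<gamma>"
  defines "N \<equiv> nat \<lfloor>\<gamma> * real s\<rfloor> + 1"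
  shows "\<exists>m\<in>{1..N}. m \<le> card {i\<in>I. q i \<le> real m * (\<alpha> / (harm N * real (card I)))}"
proof -
  define r where "r = stepdown_count s (fdp_const' s \<gamma> \<alpha>) q \<tau>"
  define n where "n j = card (\<tau> ` {1..j} \<inter> I)" for j
  note props = stepdown_count_props[where s=s and c="fdp_const' s \<gamma> \<alpha>" and q=q and \<tau>=\<tau>, folded r_def]
  have inj: "inj_on \<tau> {1..s}" and img: "\<tau> ` {1..s} = {1..s}" and mono: "mono_on {1..s} (\<lambda>k. q (\<tau> k))"
    using sorts by (auto simp: sorts_pvalues_def bij_betw_def)
  have card: "card (\<tau> ` {1..j}) = j" if "j \<le> s" for j
    using card_image[OF inj_on_subset[OF inj], of "{1..j}"] that by simp
  have "r \<noteq> 0"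
  proof
    assume "r = 0"
    then show False
      using fdp \<gamma> by (simp add: false_discovery_proportion_def stepdown_rejections_def r_def[symmetric])
  qed
  then have cross: "\<gamma> * real r < real (n r)"
    using fdp card[OF props(1)]
    by (auto simp: false_discovery_proportion_def stepdown_rejections_def r_def[symmetric] n_def
        pos_less_divide_eq)
  have step: "n (Suc j) \<le> Suc (n j)" for j
  proof -
    have "\<tau> ` {1..Suc j} \<inter> I \<subseteq> insert (\<tau> (Suc j)) (\<tau> ` {1..j} \<inter> I)"
      by (auto simp: atLeastAtMostSuc_conv)
    from card_mono[OF _ this] show ?thesis
      unfolding n_def by (simp add: card_insert_if split: if_splits)
  qed
  obtain j where j: "j \<in> {1..r}" and nj: "n j = nat \<lfloor>\<gamma> * real j\<rfloor> + 1"
    using first_crossing[OF \<gamma> _ step cross] by (auto simp: n_def)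
  have js: "j \<le> s" using j props(1) by simp
  have fin: "finite I" using I finite_subset by blast
  have "n j \<in> {1..N}"
    using nj js \<gamma> unfolding N_def by (auto intro!: nat_mono floor_mono mult_left_mono)
  have "n j \<le> card I" unfolding n_def using fin by (intro card_mono) auto
  then have I_pos: "0 < card I" using \<open>n j \<in> {1..N}\<close> by simp
  \<comment> \<open>Inclusion and exclusion for the first \<open>j\<close> rejections and the true hypotheses.\<close>
  have "card (\<tau> ` {1..j} \<union> I) \<le> card {1..s}"
    using I img js by (intro card_mono) auto
  moreover have "card (\<tau> ` {1..j} \<union> I) + n j = j + card I"
    using card_Un_Int[of "\<tau> ` {1..j}" I] fin card[OF js] by (simp add: n_def)
  ultimately have "j + card I \<le> s + n j" by simp
  then have denom: "real (card I) \<le> real s + real (n j) - real j" by linarith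
  have fl: "real_of_int \<lfloor>\<gamma> * real j\<rfloor> + 1 = real (n j)"
    using nj \<gamma> by simp
  have "fdp_const s \<gamma> \<alpha> j = real (n j) * \<alpha> / (real s + real (n j) - real j)"
    unfolding fdp_const_def fl[symmetric] by (simp add: algebra_simps)
  also have "\<dots> \<le> real (n j) * \<alpha> / real (card I)"
    using denom I_pos \<alpha> by (intro divide_left_mono) auto
  finally have "fdp_const' s \<gamma> \<alpha> j \<le> real (n j) * \<alpha> / real (card I) / harm N"
    unfolding fdp_const'_def N_def by (intro divide_right_mono harm_nonneg)
  also have "\<dots> = real (n j) * (\<alpha> / (harm N * real (card I)))" by (simp add: field_simps)
  finally have const: "fdp_const' s \<gamma> \<alpha> j \<le> real (n j) * (\<alpha> / (harm N * real (card I)))" .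
  have "q (\<tau> k) \<le> real (n j) * (\<alpha> / (harm N * real (card I)))" if "k \<in> {1..j}" for k
    using mono_onD[OF mono, of k j] props(2)[OF j] const that js by auto
  then have "\<tau> ` {1..j} \<inter> I \<subseteq> {i\<in>I. q i \<le> real (n j) * (\<alpha> / (harm N * real (card I)))}"
    by auto
  from card_mono[OF _ this] have "n j \<le> card {i\<in>I. q i \<le> real (n j) * (\<alpha> / (harm N * real (card I)))}"
    using fin unfolding n_def[symmetric] by simp
  with \<open>n j \<in> {1..N}\<close> show ?thesis by blast
qed

section \<open>Control of the false discovery proportion\<close>

theorem theorem3p3:
  fixes S :: "'x measure"
    and \<Omega> :: "'x measure set"
    and \<omega> :: "nat \<Rightarrow> 'x measure set"
    and s :: nat
    and p :: "nat \<Rightarrow> 'x \<Rightarrow> real"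
    and \<sigma> :: "'x \<Rightarrow> nat \<Rightarrow> nat"
    and \<gamma> \<alpha> :: real
    and P :: "'x measure"
  assumes "0 < \<gamma>" "\<gamma> < 1" "0 < \<alpha>" "\<alpha> < 1"
    and model: "\<And>Q. Q \<in> \<Omega> \<Longrightarrow> prob_space Q \<and> sets Q = sets S"
    and hypotheses: "\<And>i. i \<in> {1..s} \<Longrightarrow> \<omega> i \<subseteq> \<Omega>"
    and statistics: "\<And>i. i \<in> {1..s} \<Longrightarrow> p i \<in> borel_measurable S"
    and unit_valued: "\<And>i x. i \<in> {1..s} \<Longrightarrow> x \<in> space S \<Longrightarrow> p i x \<in> {0..1}"
    and pvalues: "\<And>i Q u. i \<in> {1..s} \<Longrightarrow> Q \<in> \<omega> i \<Longrightarrow> u \<in> {0<..<1} \<Longrightarrow>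
                   measure Q {x \<in> space Q. p i x \<le> u} \<le> u"
    and ordering: "\<And>x. x \<in> space S \<Longrightarrow> sorts_pvalues s (\<lambda>i. p i x) (\<sigma> x)"
    and true_distribution: "P \<in> \<Omega>"
  defines "FDP \<equiv> \<lambda>x. false_discovery_proportion
             (stepdown_rejections s (fdp_const' s \<gamma> \<alpha>) (\<lambda>i. p i x) (\<sigma> x)) (true_nulls s \<omega> P)"
  shows "{x \<in> space P. FDP x > \<gamma>} \<in> sets P \<and> measure P {x \<in> space P. FDP x > \<gamma>} \<le> \<alpha>"
proof -
  define I where "I = true_nulls s \<omega> P"
  define N where "N = nat \<lfloor>\<gamma> * real s\<rfloor> + 1"
  \<comment> \<open>If \<open>I\<close> is empty, division by zero makes \<open>c = 0\<close>; the event \<open>?E\<close> below is then empty.\<close>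
  define c where "c = \<alpha> / (harm N * real (card I))"
  interpret prob_space P using model[OF true_distribution] by simp
  have sets_P: "sets P = sets S" using model[OF true_distribution] by simp
  then have space_P: "space P = space S" by (rule sets_eq_imp_space_eq)
  have I: "I \<subseteq> {1..s}" "finite I" by (auto simp: I_def true_nulls_def)
  have p: "p i \<in> borel_measurable P" if "i \<in> {1..s}" for i
    using statistics[OF that] measurable_cong_sets[OF sets_P refl] by blast
  have mono: "mono_on {1..s} (fdp_const' s \<gamma> \<alpha>)"
    using assms(1-3) by (intro fdp_const'_mono) auto
  have ev: "{x \<in> space P. FDP x > \<gamma>} \<in> events"
  proof (rule sets_determined_by_finitely_many_events[where A="{1..s} \<times> {1..s}"
        and Q="\<lambda>a x. p (fst a) x \<le> fdp_const' s \<gamma> \<alpha> (snd a)"])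
    show "{x \<in> space P. p (fst a) x \<le> fdp_const' s \<gamma> \<alpha> (snd a)} \<in> events"
      if "a \<in> {1..s} \<times> {1..s}" for a
    proof -
      have [measurable]: "p (fst a) \<in> borel_measurable P" using that by (intro p) auto
      show ?thesis by measurable
    qed
    fix x y
    assume xy: "x \<in> space P" "y \<in> space P" "\<gamma> < FDP x"
      and same: "\<And>a. a \<in> {1..s} \<times> {1..s} \<Longrightarrow>
        (p (fst a) x \<le> fdp_const' s \<gamma> \<alpha> (snd a)) = (p (fst a) y \<le> fdp_const' s \<gamma> \<alpha> (snd a))"
    have "FDP x = FDP y"
      unfolding FDP_def
      by (subst stepdown_rejections_cong[OF ordering ordering mono, of x y])
        (use xy space_P same in auto)
    with xy show "\<gamma> < FDP y" by simp
  qed simp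
  have N: "0 < (harm N :: real)" "1 \<le> N" using harm_pos[of N] by (simp_all add: N_def)
  have c: "0 \<le> c" using assms(3) by (simp add: c_def harm_nonneg)
  have marginal: "prob {x \<in> space P. p i x \<le> real m * c} \<le> real m * c"
    if i: "i \<in> I" and m: "m \<in> {1..N}" for i m
  \<comment> \<open>For \<open>m > card I\<close> the barrier may reach \<open>1\<close>, where the bound on the probability is trivial.\<close>
  proof (cases "real m * c < 1")
    case True
    have "0 < card I" using i I(2) by (auto simp: card_gt_0_iff)
    then have "0 < real m * c" using m assms(3) N by (simp add: c_def)
    with True show ?thesis
      using i by (intro pvalues) (auto simp: I_def true_nulls_def)
  next
    case False
    then show ?thesis using prob_le_1[of "{x \<in> space P. p i x \<le> real m * c}"] by linarith
  qed
  let ?E = "{x \<in> space P. \<exists>m\<in>{1..N}. m \<le> card {i\<in>I. p i x \<le> real m * c}}"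
  have "{x \<in> space P. FDP x > \<gamma>} \<subseteq> ?E"
  proof
    fix x assume x: "x \<in> {x \<in> space P. FDP x > \<gamma>}"
    then show "x \<in> ?E"
      using fdp_exceeds_imp_order_statistic_le_barrier[OF _ _ ordering I(1), of \<gamma> \<alpha> x] assms(1,3) space_P
      unfolding FDP_def I_def[symmetric] N_def[symmetric] c_def[symmetric] by auto
  qed
  moreover have "?E \<in> events"
    using I p by (intro sets_order_statistic_le_barrier) auto
  ultimately have "prob {x \<in> space P. FDP x > \<gamma>} \<le> prob ?E"
    by (rule finite_measure_mono)
  also have "\<dots> \<le> real (card I) * (\<Sum>m=1..N. (real m * c - real (m - 1) * c) / real m)"
    using I p c marginal
    by (intro prob_order_statistic_le_barrier) (auto intro!: mono_onI mult_right_mono)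
  also have "(\<Sum>m=1..N. (real m * c - real (m - 1) * c) / real m) = c * harm N"
    unfolding harm_def sum_distrib_left
    by (intro sum.cong) (auto simp: of_nat_diff field_simps)
  also have "real (card I) * (c * harm N) \<le> \<alpha>"
    using N assms(3) by (auto simp: c_def)
  finally show ?thesis using ev by simp
qed

end
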